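(* Let $\alpha=\alpha_1\cdots\alpha_n$ and $\beta=\beta_1\cdots\beta_n$ be two words of positive integers on which the SR algorithm does not terminate. If $s_{\alpha_1}s_{\alpha_2}\cdots s_{\alpha_n}=s_{\beta_1}s_{\beta_2}\cdots s_{\beta_n}$ as permutations, then $\mathrm{shape}(R(\alpha))=\mathrm{shape}(R(\beta))$.
   Context: $s_i$ denotes the adjacent transposition $(i,i+1)$ of the positive integers. A cell is a pair $(i,j)$ of integers with $i\ge 1$, $j\ge 0$. A tower diagram is a finite set $\mathcal T$ of cells such that $(i,j)\in\mathcal T$ and $0\le k\le j$ imply $(i,k)\in\mathcal T$. The cell $(i,j)$ lies on the diagonal $x+y=i+j$. Sliding: for a positive integer $\alpha$, $\alpha^{\searrow}\mathcal T$ is computed by the procedure $P(\gamma,m)$ started at $\gamma=\alpha$, $m=1$: (S1) if no cell $(i,j)\in\mathcal T$ with $i\ge m$ lies on $x+y=\gamma-1$: (a) if $(\gamma,0)\notin\mathcal T$ the result is $\mathcal T\cup\{(\gamma,0)\}$; (b) if $(\gamma,0)\in\mathcal T$, $(\gamma,1)\notin\mathcal T$ the slide terminates (without result); (c) if $(\gamma,0),(\gamma,1)\in\mathcal T$, continue with $P(\gamma+1,\gamma+1)$. (S2) Otherwise let $i\ge m$ be smallest with $(i,\gamma-1-i)\in\mathcal T$: (a) if $(i,\gamma-i)\notin\mathcal T$ the result is $\mathcal T\cup\{(i,\gamma-i)\}$; (b) if $(i,\gamma-i)\in\mathcal T$, $(i,\gamma-i+1)\notin\mathcal T$ the slide terminates;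 (c) if both are in $\mathcal T$, continue with $P(\gamma+1,i+1)$. SR algorithm: for a word $\alpha=\alpha_1\cdots\alpha_n$, set $\mathcal T^{(0)}=\varnothing$, $\mathcal T^{(k)}=\alpha_k^{\searrow}\mathcal T^{(k-1)}$; if some slide terminates, the algorithm terminates. Otherwise $\mathcal T^{(k)}=\mathcal T^{(k-1)}\cup\{d_k\}$, the recording tableau $R(\alpha)$ labels $d_k$ by $k$, and $\mathrm{shape}(R(\alpha))=\mathcal T^{(n)}$. *)

theory Defs
  imports "HOL-Combinatorics.Transposition"
begin

type_synonym cell = "nat \<times> nat"
type_synonym tableau = "cell \<rightharpoonup> nat"

definition tower_diagram :: "cell set \<Rightarrow> bool" where
  "tower_diagram T \<longleftrightarrow> finite T \<and> (\<forall>(i, j) \<in> T. 1 \<le> i \<and> (\<forall>k \<le> j. (i, k) \<in> T))"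

text \<open>Column \<open>i\<close> of \<open>T\<close> contains a cell on the diagonal \<open>x + y = g - 1\<close>. The guard \<open>i < g\<close> rules out truncated subtraction (the second coordinate of a cell is
  nonnegative).\<close>

definition meets :: "cell set \<Rightarrow> nat \<Rightarrow> nat \<Rightarrow> bool" where
  "meets T g i \<longleftrightarrow> i < g \<and> (i, g - 1 - i) \<in> T"

text \<open>The procedure \<open>P(g, m)\<close> on \<open>T\<close>. It returns the cell \<open>d\<close> added to \<open>T\<close>, so that the
  result of the slide is \<open>insert d T\<close>, or \<open>None\<close> if the slide terminates without result.
  A formally infinite recursion would also give \<open>None\<close>, but this cannot happen for finite \<open>T\<close>:
  each recursive call requires a cell of \<open>T\<close> on the diagonal \<open>x + y = g + 1\<close>, and
  \<open>g\<close> increases.\<close>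

partial_function (option) slide_from :: "cell set \<Rightarrow> nat \<Rightarrow> nat \<Rightarrow> cell option" where
  "slide_from T g m =
    (if \<not> (\<exists>i \<ge> m. meets T g i) then
       (if (g, 0) \<notin> T then Some (g, 0)
        else if (g, 1) \<notin> T then None
        else slide_from T (g + 1) (g + 1))
     else
       (let i = (LEAST i. m \<le> i \<and> meets T g i) in
        if (i, g - i) \<notin> T then Some (i, g - i)
        else if (i, g - i + 1) \<notin> T then None
        else slide_from T (g + 1) (i + 1)))"

definition slide_cell :: "nat \<Rightarrow> cell set \<Rightarrow> cell option" where
  "slide_cell a T = slide_from T a 1"

text \<open>The current diagram is the domain of the tableau built so far; \<open>k\<close> is the next label.\<close>

fun SR_from :: "nat \<Rightarrow> tableau \<Rightarrow> nat list \<Rightarrow> tableau option" where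
  "SR_from k R [] = Some R"
| "SR_from k R (a # w) =
    (case slide_cell a (dom R) of
       None \<Rightarrow> None
     | Some d \<Rightarrow> SR_from (k + 1) (R(d \<mapsto> k)) w)"

text \<open>\<open>None\<close> means that the SR algorithm terminates; otherwise the value is the recording
  tableau of the word.\<close>

definition SR :: "nat list \<Rightarrow> tableau option" where
  "SR w = SR_from 1 Map.empty w"

definition shape :: "tableau \<Rightarrow> cell set" where
  "shape R = dom R"

text \<open>The adjacent transposition \<open>(i, i + 1)\<close>, as a permutation of \<open>nat\<close> fixing \<open>0\<close>
  when \<open>i\<close> is positive.\<close>

definition adj :: "nat \<Rightarrow> nat \<Rightarrow> nat" where
  "adj i = transpose i (i + 1)"

definition word_perm :: "nat list \<Rightarrow> nat \<Rightarrow> nat" where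
  "word_perm w = foldr (\<lambda>a p. adj a \<circ> p) w id"

lemma slide_from_column:
  assumes "slide_from T g m = Some d" "1 \<le> g" "1 \<le> m"
  shows "d \<notin> T \<and> 1 \<le> fst d \<and> (snd d = 0 \<or> (fst d, snd d - 1) \<in> T)"
proof -
  have "1 \<le> g \<longrightarrow> 1 \<le> m \<longrightarrow>
      d \<notin> T \<and> 1 \<le> fst d \<and> (snd d = 0 \<or> (fst d, snd d - 1) \<in> T)"
  proof (rule slide_from.raw_induct[OF _ assms(1),
      where P = "\<lambda>T g m d. 1 \<le> g \<longrightarrow> 1 \<le> m \<longrightarrow>
        d \<notin> T \<and> 1 \<le> fst d \<and> (snd d = 0 \<or> (fst d, snd d - 1) \<in> T)"],
      intro impI)
    fix slide T and g m :: nat and d :: cell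
    assume IH: "\<And>T g m d. slide T g m = Some d \<Longrightarrow> 1 \<le> g \<longrightarrow> 1 \<le> m \<longrightarrow>
        d \<notin> T \<and> 1 \<le> fst d \<and> (snd d = 0 \<or> (fst d, snd d - 1) \<in> T)"
      and eq: "(if \<not> (\<exists>i \<ge> m. meets T g i) then
          (if (g, 0) \<notin> T then Some (g, 0)
           else if (g, 1) \<notin> T then None
           else slide T (g + 1) (g + 1))
        else
          (let i = (LEAST i. m \<le> i \<and> meets T g i) in
           if (i, g - i) \<notin> T then Some (i, g - i)
           else if (i, g - i + 1) \<notin> T then None
           else slide T (g + 1) (i + 1))) = Some d"
      and pos: "1 \<le> g" "1 \<le> m"
    show "d \<notin> T \<and> 1 \<le> fst d \<and> (snd d = 0 \<or> (fst d, snd d - 1) \<in> T)"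
    proof (cases "\<exists>i \<ge> m. meets T g i")
      case False
      have "(if (g, 0) \<notin> T then Some (g, 0)
           else if (g, 1) \<notin> T then None
           else slide T (g + 1) (g + 1)) = Some d"
        using eq unfolding if_P[OF False] .
      then consider "d = (g, 0)" "d \<notin> T" | "slide T (g + 1) (g + 1) = Some d"
        by (metis option.distinct(1) option.inject)
      then show ?thesis
      proof cases
        case 1
        then show ?thesis using pos by simp
      next
        case 2
        show ?thesis using IH[OF 2] by (metis le_add2)
      qed
    next
      case True
      define i where "i = (LEAST i. m \<le> i \<and> meets T g i)"
      have "\<exists>i. m \<le> i \<and> meets T g i" using True by blast
      from LeastI_ex[OF this] have i: "m \<le> i" "meets T g i"
        unfolding i_def by blast+
      have "g - 1 - i = g - i - 1" by simp
      with i(2) have prev: "(i, g - i - 1) \<in> T"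
        unfolding meets_def by metis
      have nn: "\<not> \<not> (\<exists>i \<ge> m. meets T g i)" using True by blast
      have "(if (i, g - i) \<notin> T then Some (i, g - i)
           else if (i, g - i + 1) \<notin> T then None
           else slide T (g + 1) (i + 1)) = Some d"
        using eq unfolding if_not_P[OF nn] Let_def i_def[symmetric] .
      then consider "d = (i, g - i)" "d \<notin> T" | "slide T (g + 1) (i + 1) = Some d"
        by (metis option.distinct(1) option.inject)
      then show ?thesis
      proof cases
        case 1
        then show ?thesis using pos i(1) prev by simp
      next
        case 2
        show ?thesis using IH[OF 2] by (metis le_add2)
      qed
    qed
  qed
  then show ?thesis using assms(2,3) by blast
qed

text \<open>Along a word of positive integers, every diagram produced is a tower diagram, and each
  label is put on a new cell.\<close>

lemma slide_cell_tower:
  assumes "tower_diagram T" "1 \<le> a" "slide_cell a T = Some d"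
  shows "d \<notin> T \<and> tower_diagram (insert d T)"
proof -
  obtain i j where d: "d = (i, j)" by (cases d)
  have "slide_from T a 1 = Some (i, j)"
    using assms(3) by (simp only: slide_cell_def d)
  from slide_from_column[OF this assms(2) order.refl]
  have new: "(i, j) \<notin> T" "1 \<le> i" "j = 0 \<or> (i, j - 1) \<in> T"
    unfolding fst_conv snd_conv by blast+
  have T: "finite T" "\<And>i j. (i, j) \<in> T \<Longrightarrow> 1 \<le> i"
    "\<And>i j k. (i, j) \<in> T \<Longrightarrow> k \<le> j \<Longrightarrow> (i, k) \<in> T"
    using assms(1) by (auto simp: tower_diagram_def)
  have "1 \<le> i' \<and> (\<forall>k \<le> j'. (i', k) \<in> insert (i, j) T)" if "(i', j') \<in> insert (i, j) T" for i' j'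
  proof (cases "(i', j') \<in> T")
    case True
    then show ?thesis using T(2)[OF True] T(3)[OF True] by simp
  next
    case False
    with that have eq: "i' = i" "j' = j" by simp_all
    have "(i, k) \<in> insert (i, j) T" if "k \<le> j" for k
    proof (cases "k = j")
      case False
      with that have k: "k \<le> j - 1" "j \<noteq> 0" by linarith+
      with new(3) have "(i, j - 1) \<in> T" by simp
      from T(3)[OF this k(1)] show ?thesis by simp
    qed simp
    with new(2) eq show ?thesis by simp
  qed
  with T(1) have "tower_diagram (insert (i, j) T)"
    by (simp only: tower_diagram_def finite_insert split_paired_Ball_Sigma Ball_def
        split_paired_All case_prod_conv) blast
  with new(1) d show ?thesis by simp
qed

lemma tower_diagram_SR_from:
  assumes "SR_from k R0 w = Some R" "tower_diagram (dom R0)" "\<forall>a \<in> set w. 1 \<le> a"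
  shows "tower_diagram (dom R)"
  using assms
proof (induction w arbitrary: k R0)
  case Nil
  then show ?case by simp
next
  case (Cons a w)
  from Cons.prems(1) obtain d where d: "slide_cell a (dom R0) = Some d"
    and R: "SR_from (k + 1) (R0(d \<mapsto> k)) w = Some R"
    by (simp split: option.splits)
  have "1 \<le> a" using Cons.prems(3) by simp
  then have "tower_diagram (dom (R0(d \<mapsto> k)))"
    using slide_cell_tower[OF Cons.prems(2) _ d] by simp
  moreover have "\<forall>a \<in> set w. 1 \<le> a" using Cons.prems(3) by simp
  ultimately show ?case using Cons.IH[OF R] by blast
qed

lemma tower_diagram_shape:
  assumes "SR w = Some R" "\<forall>a \<in> set w. 1 \<le> a"
  shows "tower_diagram (shape R)"
proof -
  have "tower_diagram (dom Map.empty)"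
    by (simp add: tower_diagram_def)
  then show ?thesis
    using tower_diagram_SR_from[OF _ _ assms(2)] assms(1) unfolding SR_def shape_def by blast
qed

end

(* Read the columns of a tower diagram T from right to left, a column i of height h contributing
   the factor s_i s_{i+1} ... s_{i+h-1}; let w_T be the product. Sliding a letter g into T
   moves s_g leftwards through this product: it commutes with the columns it does not meet, turns
   into s_{g+1} when it passes a column reaching high enough above the diagonal, and extends the
   column at which the slide stops. Hence the shape T of a word has w_T equal to the permutation
   of the word. Finally T is determined by w_T: only the leftmost column moves the smallest point
   1, so its height can be read off from the preimage of 1, and one cancels this column. *)
theory Submission
  imports Defs
begin

section \<open>Words in adjacent transpositions and their relations\<close>

lemma word_perm_Nil [simp]: "word_perm [] = id"
  by (simp add: word_perm_def)

lemma word_perm_Cons [simp]: "word_perm (a # w) = adj a \<circ> word_perm w"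
  by (simp add: word_perm_def)

lemma word_perm_append: "word_perm (u @ v) = word_perm u \<circ> word_perm v"
  by (induction u) (simp_all add: comp_assoc)

lemma bij_word_perm: "bij (word_perm w)"
proof (induction w)
  case (Cons a w)
  moreover have "bij (adj a)" by (simp add: adj_def)
  ultimately show ?case unfolding word_perm_Cons by (rule bij_comp)
qed (simp only: word_perm_Nil bij_id)

lemma adj_commute: "a + 1 < b \<Longrightarrow> adj a \<circ> adj b = adj b \<circ> adj a"
  by (auto simp: adj_def fun_eq_iff transpose_def)

lemma adj_braid: "adj a \<circ> adj (a + 1) \<circ> adj a = adj (a + 1) \<circ> adj a \<circ> adj (a + 1)"
  by (auto simp: adj_def fun_eq_iff transpose_def)

lemma word_perm_commute_adj:
  assumes "\<And>b. b \<in> set w \<Longrightarrow> b + 1 < a \<or> a + 1 < b"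
  shows "word_perm w \<circ> adj a = adj a \<circ> word_perm w"
  using assms
proof (induction w)
  case (Cons b w)
  then have "word_perm w \<circ> adj a = adj a \<circ> word_perm w" by (meson list.set_intros(2))
  moreover have "adj b \<circ> adj a = adj a \<circ> adj b"
    using Cons.prems[of b] adj_commute[of a b] adj_commute[of b a] by auto
  ultimately show ?case by (metis comp_assoc word_perm_Cons)
qed simp

lemma word_perm_fixes:
  assumes "\<forall>b \<in> set w. x < b"
  shows "word_perm w x = x"
  using assms by (induction w) (auto simp: adj_def transpose_def)

text \<open>The letters of \<open>[i..<g]\<close> commute with \<open>adj (g + 1)\<close>, those of
  \<open>[g + 2..<n]\<close> with \<open>adj g\<close>, and the braid relation handles the letters
  \<open>g\<close>, \<open>g + 1\<close> between them; \<open>g + 1 < n\<close> ensures that both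
  occur.\<close>

lemma word_perm_upt_shift:
  assumes "i \<le> g" "g + 1 < n"
  shows "word_perm [i..<n] \<circ> adj g = adj (g + 1) \<circ> word_perm [i..<n]"
proof -
  define u v where "u = word_perm [i..<g]" and "v = word_perm [g + 2..<n]"
  have "[i..<n] = [i..<g] @ g # (g + 1) # [g + 2..<n]"
    using assms upt_add_eq_append[of i g "n - g"] by (simp add: upt_conv_Cons)
  then have split: "word_perm [i..<n] = u \<circ> (adj g \<circ> (adj (g + 1) \<circ> v))"
    by (simp add: word_perm_append u_def v_def)
  have u: "u \<circ> adj (g + 1) = adj (g + 1) \<circ> u" and v: "v \<circ> adj g = adj g \<circ> v"
    unfolding u_def v_def by (auto intro!: word_perm_commute_adj)
  have "word_perm [i..<n] \<circ> adj g = u \<circ> (adj g \<circ> adj (g + 1) \<circ> adj g) \<circ> v"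
    by (simp add: split comp_assoc v)
  also have "\<dots> = u \<circ> adj (g + 1) \<circ> (adj g \<circ> adj (g + 1) \<circ> v)"
    unfolding adj_braid by (simp only: comp_assoc)
  also have "\<dots> = adj (g + 1) \<circ> word_perm [i..<n]"
    by (simp only: u split comp_assoc)
  finally show ?thesis .
qed

text \<open>The last letter acts first, so the point descends one step per letter.\<close>

lemma word_perm_upt_end: "word_perm [i..<i + h] (i + h) = i"
  by (induction h) (simp_all add: word_perm_append adj_def)

section \<open>Column heights and the reading word\<close>

definition height :: "cell set \<Rightarrow> nat \<Rightarrow> nat" where
  "height T i = card {j. (i, j) \<in> T}"

text \<open>A finite downward closed set of naturals is an initial segment, hence determined by its
  cardinality. The membership tests of the slide thus become inequalities.\<close>

lemma mem_iff_less_height: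
  assumes "tower_diagram T"
  shows "(i, j) \<in> T \<longleftrightarrow> j < height T i"
proof -
  let ?A = "{j. (i, j) \<in> T}"
  have "finite ?A"
    using assms finite_vimageI[of T "Pair i"] by (simp add: tower_diagram_def vimage_def inj_on_def)
  have down: "k \<in> ?A" if "j \<in> ?A" "k \<le> j" for j k
    using assms that by (auto simp: tower_diagram_def)
  have "?A = {..<height T i}"
  proof (cases "?A = {}")
    case True
    then show ?thesis unfolding height_def True by simp
  next
    case False
    then have "?A = {..Max ?A}"
      using down[OF Max_in[OF \<open>finite ?A\<close>]] Max_ge[OF \<open>finite ?A\<close>] by blast
    then obtain M where M: "?A = {..M}" by blast
    show ?thesis unfolding height_def M by (simp add: lessThan_Suc_atMost)
  qed
  then show ?thesis by blast
qed

lemma height_insert: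
  assumes "tower_diagram T"
  shows "height (insert (i, height T i) T) = (height T)(i := height T i + 1)"
proof
  fix k
  have col: "{j. (k, j) \<in> T} = {..<height T k}"
    using mem_iff_less_height[OF assms] by auto
  have "{j. (k, j) \<in> insert (i, height T i) T} = (if k = i then {..height T i} else {..<height T k})"
    using mem_iff_less_height[OF assms] by auto
  then show "height (insert (i, height T i) T) k = ((height T)(i := height T i + 1)) k"
    unfolding height_def[of "insert _ _"] by simp
qed

text \<open>The window \<open>[m..<n]\<close> lets inductions peel off columns from the left.
  Columns without cells contribute the empty word, so any large \<open>n\<close> serves.\<close>

definition reading :: "cell set \<Rightarrow> nat \<Rightarrow> nat \<Rightarrow> nat list" where
  "reading T m n = concat (map (\<lambda>i. [i..<i + height T i]) (rev [m..<n]))"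

lemma reading_split:
  assumes "m \<le> i" "i < n"
  shows "reading T m n = reading T (i + 1) n @ [i..<i + height T i] @ reading T m i"
proof -
  have "[m..<n] = [m..<i] @ i # [i + 1..<n]"
    using assms upt_add_eq_append[of m i "n - i"] by (simp add: upt_conv_Cons)
  then show ?thesis by (simp add: reading_def)
qed

lemma reading_cong:
  assumes "\<And>k. m \<le> k \<Longrightarrow> k < n \<Longrightarrow> height T k = height T' k"
  shows "reading T m n = reading T' m n"
  unfolding reading_def by (intro arg_cong[of _ _ concat] map_cong) (use assms in auto)

section \<open>Sliding a letter as right multiplication\<close>

text \<open>The cases S1 and S2 of the procedure become one case by letting column \<open>g\<close> itself be
  selected when no column meets the diagonal.\<close>

lemma slide_from_step:
  assumes "tower_diagram T" "m \<le> g"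
  obtains i where "m \<le> i" "i \<le> g" "g \<le> i + height T i"
    "\<And>k. m \<le> k \<Longrightarrow> k < i \<Longrightarrow> k + height T k < g"
    "slide_from T g m =
      (if height T i = g - i then Some (i, g - i)
       else if height T i = g - i + 1 then None
       else slide_from T (g + 1) (i + 1))"
proof -
  have mem: "(i, j) \<in> T \<longleftrightarrow> j < height T i" for i j
    using mem_iff_less_height[OF assms(1)] .
  have meets: "meets T g i \<longleftrightarrow> i < g \<and> g \<le> i + height T i" for i
    unfolding meets_def mem by auto
  show ?thesis
  proof (cases "\<exists>i \<ge> m. meets T g i")
    case False
    \<comment> \<open>For \<open>i = g\<close> the cells \<open>(g, 0)\<close> and
      \<open>(g, 1)\<close> of S1 are \<open>(i, g - i)\<close> and
      \<open>(i, g - i + 1)\<close>.\<close>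
    show thesis
    proof (rule that[of g])
      show "slide_from T g m =
        (if height T g = g - g then Some (g, g - g)
         else if height T g = g - g + 1 then None
         else slide_from T (g + 1) (g + 1))"
        using False by (subst slide_from.simps) (auto simp: mem)
      show "k + height T k < g" if "m \<le> k" "k < g" for k
        using False that unfolding meets by force
    qed (use assms in auto)
  next
    case True
    define i where "i = (LEAST i. m \<le> i \<and> meets T g i)"
    have i: "m \<le> i \<and> meets T g i"
      unfolding i_def by (rule LeastI_ex) (use True in blast)
    \<comment> \<open>The double negation matches the negated condition of the \<open>if\<close>, as
      \<open>if_not_P\<close> requires.\<close>
    have meeting: "\<not> \<not> (\<exists>i \<ge> m. meets T g i)" using True by blast
    show thesis
    proof (rule that[of i])
      have "slide_from T g m =
        (if (i, g - i) \<notin> T then Some (i, g - i)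
         else if (i, g - i + 1) \<notin> T then None
         else slide_from T (g + 1) (i + 1))"
        using slide_from.simps[of T g m] unfolding if_not_P[OF meeting] Let_def i_def[symmetric] .
      \<comment> \<open>Column \<open>i\<close> has height at least \<open>g - i\<close>, since it
        meets the diagonal; the first missing cell then fixes its height.\<close>
      then show "slide_from T g m =
        (if height T i = g - i then Some (i, g - i)
         else if height T i = g - i + 1 then None
         else slide_from T (g + 1) (i + 1))"
        using i unfolding mem meets by auto
      show "k + height T k < g" if "m \<le> k" "k < i" for k
        using not_less_Least[of k "\<lambda>i. m \<le> i \<and> meets T g i", folded i_def] that i
        unfolding meets by auto
    qed (use i meets in auto)
  qed
qed

text \<open>Induction on the number of columns left to pass: \<open>g\<close> grows in a recursive
  call, but \<open>n - m\<close> falls. The bound on \<open>fst d\<close> is carried along because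
  the columns already passed must stay unchanged.\<close>

lemma word_perm_reading_slide_from:
  assumes "tower_diagram T" "m \<le> g" "slide_from T g m = Some d"
    and "fst ` insert d T \<subseteq> {..<n}"
  shows "m \<le> fst d \<and>
    word_perm (reading (insert d T) m n) = word_perm (reading T m n) \<circ> adj g"
  using assms(2,3)
proof (induction "n - m" arbitrary: m g rule: less_induct)
  case less
  obtain i where i: "m \<le> i" "i \<le> g" "g \<le> i + height T i"
    and below: "\<And>k. m \<le> k \<Longrightarrow> k < i \<Longrightarrow> k + height T k < g"
    and step: "slide_from T g m =
      (if height T i = g - i then Some (i, g - i)
       else if height T i = g - i + 1 then None
       else slide_from T (g + 1) (i + 1))"
    by (rule slide_from_step[OF assms(1) less.prems(1)]) blast
  \<comment> \<open>Beyond the bound column \<open>i\<close> is empty, which forces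
    \<open>g = i\<close> and stops the slide at \<open>(i, 0)\<close>, outside the bound on
    \<open>d\<close>.\<close>
  have "i < n"
  proof (rule ccontr)
    assume "\<not> i < n"
    then have "(i, 0) \<notin> T" using assms(4) by force
    then have "height T i = 0" by (simp add: mem_iff_less_height[OF assms(1)])
    then have "d = (i, 0)" using i step less.prems(2) by simp
    then show False using assms(4) \<open>\<not> i < n\<close> by simp
  qed
  \<comment> \<open>A column \<open>k\<close> below the diagonal has only letters \<open>b\<close>
    with \<open>b + 1 < g\<close>.\<close>
  have comm: "word_perm (reading T m i) \<circ> adj g = adj g \<circ> word_perm (reading T m i)"
  proof (rule word_perm_commute_adj)
    fix b assume "b \<in> set (reading T m i)"
    then obtain k where "m \<le> k" "k < i" "b < k + height T k" by (auto simp: reading_def)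
    then show "b + 1 < g \<or> g + 1 < b" using below by force
  qed
  show ?case
  proof (cases "height T i = g - i")
    case True
    then have d: "d = (i, height T i)" using step less.prems(2) by simp
    have h: "height (insert d T) = (height T)(i := height T i + 1)"
      unfolding d by (rule height_insert[OF assms(1)])
    have "reading (insert d T) (i + 1) n = reading T (i + 1) n"
      "reading (insert d T) m i = reading T m i"
      by (auto intro!: reading_cong simp: h)
    \<comment> \<open>The letter of the new top cell is \<open>i + (g - i) = g\<close>.\<close>
    moreover have "[i..<i + height (insert d T) i] = [i..<i + height T i] @ [g]"
      using True i by (simp add: h)
    ultimately show ?thesis
      using i \<open>i < n\<close> comm
      by (simp add: d reading_split[of m i n] word_perm_append comp_assoc)
  next
    case False
    \<comment> \<open>Height \<open>g - i + 1\<close>, where \<open>adj g\<close> would cancel the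
      last letter of the column, ends the slide without result; so the column is high enough for the
      shift.\<close>
    then have rec: "slide_from T (g + 1) (i + 1) = Some d" and high: "g + 1 < i + height T i"
      using step less.prems(2) i by (auto split: if_splits)
    have "n - (i + 1) < n - m" using i(1) \<open>i < n\<close> by simp
    from less.hyps[OF this _ rec] i(2)
    have fst: "i + 1 \<le> fst d"
      and IH: "word_perm (reading (insert d T) (i + 1) n) = word_perm (reading T (i + 1) n) \<circ> adj (g + 1)"
      by auto
    have h: "height (insert d T) k = height T k" if "k \<le> i" for k
      using fst that unfolding height_def by (intro arg_cong[of _ _ card]) auto
    have same: "reading (insert d T) m i = reading T m i"
      by (rule reading_cong) (simp add: h)
    have "word_perm (reading (insert d T) m n) =
        word_perm (reading T (i + 1) n) \<circ> (adj (g + 1) \<circ> word_perm [i..<i + height T i])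
          \<circ> word_perm (reading T m i)"
      using i \<open>i < n\<close> IH by (simp add: reading_split[of m i n] word_perm_append h same comp_assoc)
    also have "\<dots> = word_perm (reading T (i + 1) n) \<circ> word_perm [i..<i + height T i]
          \<circ> (adj g \<circ> word_perm (reading T m i))"
      unfolding word_perm_upt_shift[OF i(2) high, symmetric] by (simp only: comp_assoc)
    also have "\<dots> = word_perm (reading T m n) \<circ> adj g"
      using i \<open>i < n\<close>
      by (simp only: comm[symmetric] reading_split[of m i n] word_perm_append comp_assoc)
    finally show ?thesis using fst i(1) by simp
  qed
qed

text \<open>Transfers the column bound \<open>n\<close> from the final diagram to all intermediate
  ones.\<close>

lemma dom_SR_from_mono: "SR_from k R0 w = Some R \<Longrightarrow> dom R0 \<subseteq> dom R"
proof (induction w arbitrary: k R0)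
  case (Cons a w)
  then obtain d where "SR_from (k + 1) (R0(d \<mapsto> k)) w = Some R"
    by (auto split: option.splits)
  from Cons.IH[OF this] show ?case unfolding dom_fun_upd by simp
qed simp

lemma word_perm_reading_SR_from:
  assumes "SR_from k R0 w = Some R" "tower_diagram (dom R0)" "\<forall>a \<in> set w. 1 \<le> a"
    and "fst ` dom R \<subseteq> {..<n}"
  shows "word_perm (reading (dom R) 1 n) = word_perm (reading (dom R0) 1 n) \<circ> word_perm w"
  using assms(1-3)
proof (induction w arbitrary: k R0)
  case (Cons a w)
  from Cons.prems(1) obtain d where d: "slide_cell a (dom R0) = Some d"
    and R: "SR_from (k + 1) (R0(d \<mapsto> k)) w = Some R"
    by (simp split: option.splits)
  have "1 \<le> a" using Cons.prems(3) by simp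
  have dom: "dom (R0(d \<mapsto> k)) = insert d (dom R0)" by simp
  have tower: "tower_diagram (insert d (dom R0))"
    using slide_cell_tower[OF Cons.prems(2) \<open>1 \<le> a\<close> d] by simp
  have "insert d (dom R0) \<subseteq> dom R" using dom_SR_from_mono[OF R] dom by simp
  then have "fst ` insert d (dom R0) \<subseteq> {..<n}" using assms(4) by blast
  then have "word_perm (reading (insert d (dom R0)) 1 n) = word_perm (reading (dom R0) 1 n) \<circ> adj a"
    using word_perm_reading_slide_from[OF Cons.prems(2) \<open>1 \<le> a\<close>] d
    unfolding slide_cell_def by blast
  then show ?case
    using Cons.IH[OF R, unfolded dom, OF tower] Cons.prems(3)
    by (metis comp_assoc list.set_intros(2) word_perm_Cons)
qed simp

lemma word_perm_reading_SR:
  assumes "SR w = Some R" "\<forall>a \<in> set w. 1 \<le> a" "fst ` shape R \<subseteq> {..<n}"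
  shows "word_perm (reading (shape R) 1 n) = word_perm w"
proof -
  have "reading {} 1 n = []" by (simp add: reading_def height_def)
  then show ?thesis
    using word_perm_reading_SR_from[of 1 Map.empty w R n] assms
    by (simp add: SR_def shape_def tower_diagram_def)
qed

section \<open>Recovering the diagram from the permutation\<close>

text \<open>Column \<open>m\<close> acts first and brings the point down to \<open>m\<close>; the
  columns to its right have only letters above \<open>m\<close> and fix it.\<close>

lemma word_perm_reading_preimage:
  assumes "m < n"
  shows "word_perm (reading T m n) (m + height T m) = m"
proof -
  have "word_perm (reading T (m + 1) n) m = m"
    by (rule word_perm_fixes) (auto simp: reading_def)
  moreover have "reading T m m = []" by (simp add: reading_def)
  ultimately show ?thesis
    using assms by (simp add: reading_split[of m m n] word_perm_append word_perm_upt_end)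
qed

lemma height_eq_of_word_perm_reading_eq:
  assumes "word_perm (reading T m n) = word_perm (reading T' m n)" "m \<le> k" "k < n"
  shows "height T k = height T' k"
  using assms
proof (induction "n - m" arbitrary: m)
  case (Suc l)
  have "m < n" using Suc.prems by simp
  \<comment> \<open>Both values are \<open>m\<close>, the second because the two permutations agree;
    injectivity then gives equal heights.\<close>
  have "word_perm (reading T m n) (m + height T m) = word_perm (reading T m n) (m + height T' m)"
    by (metis word_perm_reading_preimage[OF \<open>m < n\<close>] Suc.prems(1))
  then have head: "height T m = height T' m"
    using bij_is_inj[OF bij_word_perm] by (simp add: inj_eq)
  let ?c = "word_perm [m..<m + height T m]"
  have "reading T m m = []" "reading T' m m = []" by (simp_all add: reading_def)
  then have "word_perm (reading T (m + 1) n) \<circ> ?c = word_perm (reading T' (m + 1) n) \<circ> ?c"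
    using Suc.prems(1) \<open>m < n\<close> head by (simp add: reading_split[of m m n] word_perm_append)
  \<comment> \<open>Surjectivity of \<open>?c\<close> allows it to be cancelled on the
    right.\<close>
  then have tail: "word_perm (reading T (m + 1) n) = word_perm (reading T' (m + 1) n)"
    by (intro surj_fun_eq[OF bij_is_surj[OF bij_word_perm[of "[m..<m + height T m]"]]] ballI)
      (rule fun_cong)
  show ?case
  proof (cases "k = m")
    case False
    then show ?thesis using Suc.hyps(1)[of "m + 1"] Suc.hyps(2) Suc.prems tail by simp
  qed (simp add: head)
qed simp

theorem theorem4p1:
  fixes \<alpha> \<beta> :: "nat list" and R S :: tableau
  assumes "\<forall>a \<in> set \<alpha>. 1 \<le> a" and "\<forall>b \<in> set \<beta>. 1 \<le> b"
    and "length \<alpha> = length \<beta>"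
    and "SR \<alpha> = Some R" and "SR \<beta> = Some S"
    and "word_perm \<alpha> = word_perm \<beta>"
  shows "shape R = shape S"
proof -
  have R: "tower_diagram (shape R)" and S: "tower_diagram (shape S)"
    using tower_diagram_shape assms by blast+
  \<comment> \<open>A common bound \<open>n\<close> puts both reading words over the same
    window.\<close>
  then have "finite (fst ` (shape R \<union> shape S))" by (simp add: tower_diagram_def)
  then obtain n where n: "fst ` (shape R \<union> shape S) \<subseteq> {..<n}"
    unfolding finite_nat_set_iff_bounded by blast
  have "word_perm (reading (shape R) 1 n) = word_perm (reading (shape S) 1 n)"
    using word_perm_reading_SR[of \<alpha> R n] word_perm_reading_SR[of \<beta> S n] assms n
    by (simp add: image_Un)
  then have heights: "height (shape R) i = height (shape S) i" if "1 \<le> i" "i < n" for i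
    using height_eq_of_word_perm_reading_eq that by blast
  \<comment> \<open>Outside columns \<open>1\<close> to \<open>n - 1\<close> neither shape has
    cells, so the compared heights decide every membership.\<close>
  have cols: "1 \<le> i \<and> i < n" if "(i, j) \<in> shape R \<union> shape S" for i j
    using that R S n by (force simp: tower_diagram_def)
  show ?thesis
  proof (intro set_eqI)
    fix c :: cell
    obtain i j where c: "c = (i, j)" by force
    show "c \<in> shape R \<longleftrightarrow> c \<in> shape S"
      using heights[of i] cols[of i j]
        mem_iff_less_height[OF R, of i j] mem_iff_less_height[OF S, of i j]
      unfolding c by auto
  qed
qed

end
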